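(* Let $k\geq 2$ be an integer. For every $\delta\in(0,1)$ we have $$\liminf_{N\to\infty}\frac{\phi_k(\delta,N)}{(\log N)^{1/(k-1)}}\geq\left(\frac{1}{\log(1/\delta)}\right)^{1/(k-1)}.$$
   Context: $\mathbb{N}=\{1,2,\ldots\}$, $[N]=\{1,\ldots,N\}$, and $\log$ is the natural logarithm. $B_1+\cdots+B_k=\{b_1+\cdots+b_k: b_i\in B_i\}$. For $k,N\in\mathbb{N}$ and $\delta>0$, $$\phi_k(\delta,N)=\min_{A\subseteq[N],\ |A|\geq\delta N}\ \ \max_{B_1,\ldots,B_k\subseteq[N],\ B_1+\cdots+B_k\subseteq A}\ \min\{|B_1|,\ldots,|B_k|\},$$ that is, the largest integer such that any $A\subseteq[N]$ with $|A|\geq\delta N$ contains a set $B_1+\cdots+B_k$ with $B_1,\ldots,B_k\subseteq[N]$ and $\min\{|B_1|,\ldots,|B_k|\}\geq\phi_k(\delta,N)$. *)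

theory Defs
  imports Complex_Main "HOL-Library.Extended_Real" "HOL-Library.Set_Algebras"
begin

text \<open>
  Families \<open>B\<^sub>1, \<dots>, B\<^sub>k\<close> of sets are functions \<open>B :: nat \<Rightarrow> nat set\<close> of which only the values
  on \<open>{1..k}\<close> matter.  The sum \<open>\<Sum>i=1..k. B i\<close> below is the iterated Minkowski sum
  \<open>B\<^sub>1 + \<dots> + B\<^sub>k\<close> of \<^theory>\<open>HOL-Library.Set_Algebras\<close>:
\<close>

lemma sum_sets_eq:
  fixes B :: "nat \<Rightarrow> nat set"
  shows "(\<Sum>i=1..k. B i) = {\<Sum>i=1..k. b i | b. \<forall>i\<in>{1..k}. b i \<in> B i}"
  by (simp add: set_sum_alt)

definition max_min_card :: "nat \<Rightarrow> nat \<Rightarrow> nat set \<Rightarrow> nat" where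
  "max_min_card k N A =
     Max {Min ((\<lambda>i. card (B i)) ` {1..k}) | B.
            (\<forall>i\<in>{1..k}. B i \<subseteq> {1..N}) \<and> (\<Sum>i=1..k. B i) \<subseteq> A}"

definition phi :: "nat \<Rightarrow> real \<Rightarrow> nat \<Rightarrow> nat" where
  "phi k \<delta> N = Min (max_min_card k N ` {A. A \<subseteq> {1..N} \<and> real (card A) \<ge> \<delta> * real N})"

text \<open>
  \<^const>\<open>Max\<close> and \<^const>\<open>Min\<close> are only meaningful on finite nonempty sets.  That is the case here
  as soon as \<open>k \<ge> 1\<close> and \<open>\<delta> \<le> 1\<close>: empty \<open>B\<^sub>i\<close> are admitted, and \<open>A = {1..N}\<close> is admissible.
\<close>

lemma max_min_card_finite_nonempty:
  fixes k N :: nat and A :: "nat set"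
  assumes "k \<ge> 1"
  shows "finite {Min ((\<lambda>i. card (B i)) ` {1..k}) | B.
            (\<forall>i\<in>{1..k}. B i \<subseteq> {1..N}) \<and> (\<Sum>i=1..k. B i) \<subseteq> A}" (is "finite ?S")
    and "{Min ((\<lambda>i. card (B i)) ` {1..k}) | B.
            (\<forall>i\<in>{1..k}. B i \<subseteq> {1..N}) \<and> (\<Sum>i=1..k. B i) \<subseteq> A} \<noteq> {}"
proof -
  have "m \<le> N" if "m \<in> ?S" for m
  proof -
    from that obtain B where m: "m = Min ((\<lambda>i. card (B i)) ` {1..k})"
      and B: "\<forall>i\<in>{1..k}. B i \<subseteq> {1..N}" by auto
    have "m \<le> card (B 1)"
      unfolding m using assms by (intro Min_le) auto
    also have "\<dots> \<le> N"
      using assms B card_mono[of "{1..N}" "B 1"] by simp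
    finally show ?thesis .
  qed
  then show "finite ?S"
    by (intro finite_subset[of ?S "{..N}"]) (simp_all add: subset_iff)
  have "(\<Sum>i=1..k. ({} :: nat set)) \<subseteq> A"
    using assms by (auto simp: set_sum_alt)
  then have "Min ((\<lambda>i. card ({} :: nat set)) ` {1..k}) \<in> ?S"
    by (intro CollectI exI[of _ "\<lambda>_. {}"]) simp
  then show "?S \<noteq> {}" by (rule ex_in_conv[THEN iffD1, OF exI])
qed

lemma phi_finite_nonempty:
  assumes "\<delta> \<le> 1"
  shows "finite {A. A \<subseteq> {1..N} \<and> real (card A) \<ge> \<delta> * real N}"
    and "{A. A \<subseteq> {1..N} \<and> real (card A) \<ge> \<delta> * real N} \<noteq> {}"
proof -
  show "finite {A. A \<subseteq> {1..N} \<and> real (card A) \<ge> \<delta> * real N}"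
    by (rule finite_subset[of _ "Pow {1..N}"]) auto
  have "\<delta> * real N \<le> real (card {1..N})"
    using mult_right_mono[OF assms, of "real N"] by simp
  then show "{A. A \<subseteq> {1..N} \<and> real (card A) \<ge> \<delta> * real N} \<noteq> {}" by blast
qed

end

theory Submission
  imports Defs "HOL-Real_Asymp.Real_Asymp"
begin

text \<open>
  By double counting and convexity, a set of density \<open>\<alpha>\<close> in \<open>{1..N}\<close> contains \<open>B + C\<close> with \<open>B\<close> of
  size \<open>t\<close> in the short interval \<open>{1..M}\<close> and \<open>C\<close> of density at least \<open>(\<alpha> - M/N - t/M)\<^sup>t\<close>; keeping
  \<open>M\<close> much smaller than \<open>N\<close> makes the translates of \<open>A\<close> lose almost nothing at the boundary.
  Applying this again to \<open>C\<close>, altogether \<open>k - 1\<close> times, leaves a set of density about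
  \<open>\<delta>\<close> to the power \<open>t\<^bsup>k-1\<^esup>\<close>, which serves as the last summand. It still has at least \<open>t\<close> elements
  if \<open>t\<^bsup>k-1\<^esup> ln (1/\<delta>) \<le> \<theta> ln N\<close> with \<open>\<theta> < 1\<close>. The losses are absorbed by shrinking
  \<open>\<delta>\<close> by a constant factor \<open>c < 1\<close> in each step, and \<open>M\<close> is about \<open>sqrt N\<close>.
\<close>

section \<open>Inequalities for powers: falling factorials and convexity\<close>

lemma diff_power_le_fact_binomial: "(d - t) ^ t \<le> fact t * (d choose t)"
proof (induction t arbitrary: d)
  case (Suc t)
  show ?case
  proof (cases d)
    case (Suc e)
    \<comment> \<open>The right side is a falling factorial, a product of factors that are each at
      least \<open>d - t\<close>; the induction splits off the largest one. Truncated subtraction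
      makes the left side vanish once \<open>d\<close> is too small.\<close>
    have "(e - t) ^ Suc t \<le> Suc e * (fact t * (e choose t))"
      using mult_mono[OF _ Suc.IH[of e], of "e - t" "Suc e"] by simp
    also have "\<dots> = fact t * (Suc e * (e choose t))"
      by (rule mult.left_commute)
    also have "\<dots> = fact (Suc t) * (Suc e choose Suc t)"
      by (simp only: Suc_times_binomial_eq fact_Suc of_nat_id ac_simps)
    finally show ?thesis
      by (simp add: Suc)
  qed simp
qed simp

text \<open>The left side is the tangent of \<open>x ^ n\<close> at \<open>s\<close>; the bound is
  Bernoulli's inequality for \<open>x / s - 1\<close>, which is at least -1.\<close>

lemma power_ge_tangent:
  fixes x s :: real
  assumes "0 \<le> x" "0 < s"
  shows "s ^ n * (1 + real n * (x / s - 1)) \<le> x ^ n"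
proof -
  have "1 + real n * (x / s - 1) \<le> (1 + (x / s - 1)) ^ n"
    using assms by (intro Bernoulli_inequality) simp
  then have "s ^ n * (1 + real n * (x / s - 1)) \<le> s ^ n * (x / s) ^ n"
    using assms by simp
  also have "\<dots> = x ^ n"
    using assms by (simp add: power_divide)
  finally show ?thesis .
qed

text \<open>Jensen's inequality with the tangent taken at a lower bound \<open>s\<close> of the
  mean: its slope is nonnegative, so summing the linear terms only helps.\<close>

lemma sum_power_ge:
  fixes f :: "'a \<Rightarrow> real" and s :: real
  assumes "\<And>y. y \<in> Y \<Longrightarrow> 0 \<le> f y" "0 < s" "real (card Y) * s \<le> sum f Y"
  shows "real (card Y) * s ^ n \<le> (\<Sum>y\<in>Y. f y ^ n)"
proof -
  have "0 \<le> sum f Y / s - real (card Y)"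
    using assms by (simp add: field_simps)
  then have "real (card Y) * s ^ n
      \<le> s ^ n * (real (card Y) + real n * (sum f Y / s - real (card Y)))"
    using assms by (simp add: distrib_left)
  also have "\<dots> = (\<Sum>y\<in>Y. s ^ n * (1 + real n * (f y / s - 1)))"
    by (simp add: sum_distrib_left[symmetric] sum.distrib sum_subtractf sum_divide_distrib)
  also have "\<dots> \<le> (\<Sum>y\<in>Y. f y ^ n)"
    using assms by (intro sum_mono power_ge_tangent) auto
  finally show ?thesis .
qed

section \<open>Sumsets in dense sets by double counting\<close>

lemma sum_card_swap:
  assumes "finite X" "finite Y"
  shows "(\<Sum>x\<in>X. card {y \<in> Y. P x y}) = (\<Sum>y\<in>Y. card {x \<in> X. P x y})"
  using assms by (intro sum_multicount_gen) auto

lemma card_translate_ge: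
  fixes A :: "nat set"
  assumes "A \<subseteq> {1..N}"
  shows "card A \<le> card {y \<in> {1..N}. x + y \<in> A} + x"
proof -
  have "A \<subseteq> (+) x ` {y \<in> {1..N}. x + y \<in> A} \<union> {1..x}"
  proof
    fix a assume a: "a \<in> A"
    show "a \<in> (+) x ` {y \<in> {1..N}. x + y \<in> A} \<union> {1..x}"
    proof (cases "a \<le> x")
      case False
      then have "a = x + (a - x)" "a - x \<in> {y \<in> {1..N}. x + y \<in> A}"
        using a assms by auto
      then show ?thesis by blast
    qed (use a assms in auto)
  qed
  then have "card A \<le> card ((+) x ` {y \<in> {1..N}. x + y \<in> A} \<union> {1..x})"
    by (intro card_mono) auto
  also have "\<dots> \<le> card ((+) x ` {y \<in> {1..N}. x + y \<in> A}) + card {1..x}"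
    by (rule card_Un_le)
  also have "card ((+) x ` {y \<in> {1..N}. x + y \<in> A}) = card {y \<in> {1..N}. x + y \<in> A}"
    by (intro card_image) auto
  finally show ?thesis by simp
qed

text \<open>Count pairs \<open>(B, y)\<close> with \<open>B\<close> a \<open>t\<close>-subset of
  \<open>{1..M}\<close> whose shift by \<open>y\<close> lies in \<open>A\<close>. With
  \<open>q\<close> the base of the power, there are at least \<open>N * (M * q) ^ t / t!\<close>
  pairs and at most \<open>M ^ t / t!\<close> sets \<open>B\<close>, so some \<open>B\<close> has
  \<open>q ^ t * N\<close> partners. In \<open>q\<close>, the term \<open>M / N\<close> pays for the
  boundary and \<open>t / M\<close> for replacing \<open>d choose t\<close> by
  \<open>(d - t) ^ t / t!\<close>.\<close>

lemma dense_set_contains_sumset: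
  fixes A :: "nat set" and a :: real
  assumes A: "A \<subseteq> {1..N}" "a * real N \<le> real (card A)"
    and MN: "0 < M" "0 < N"
    and pos: "0 < a - real M / real N - real t / real M"
  obtains B C where "B \<subseteq> {1..M}" "card B = t" "C \<subseteq> {1..N}" "B + C \<subseteq> A"
    "(a - real M / real N - real t / real M) ^ t * real N \<le> real (card C)"
proof -
  define D where "D y = {x \<in> {1..M}. x + y \<in> A}" for y
  define K where "K B = {y \<in> {1..N}. B \<subseteq> D y}" for B
  define \<B> where "\<B> = {B. B \<subseteq> {1..M} \<and> card B = t}"
  define q where "q = a - real M / real N - real t / real M"
  have fin: "finite \<B>"
    unfolding \<B>_def by (rule finite_subset[of _ "Pow {1..M}"]) auto
  have card_\<B>: "card \<B> = M choose t"
    unfolding \<B>_def by (simp add: n_subsets)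
  have q: "0 < q" and s: "0 < real M * q"
    using pos MN by (simp_all add: q_def)

  have "real (card {1..N}) * (real M * q) = real M * (a * real N - real M) - real N * real t"
    using MN by (simp add: q_def field_simps)
  also have "real M * (a * real N - real M) \<le> (\<Sum>x\<in>{1..M}. real (card {y \<in> {1..N}. x + y \<in> A}))"
  proof -
    have "a * real N - real M \<le> real (card {y \<in> {1..N}. x + y \<in> A})" if "x \<in> {1..M}" for x
      using card_translate_ge[OF A(1), of x] that A(2) by (simp del: of_nat_add add: of_nat_add[symmetric])
    then have "(\<Sum>x\<in>{1..M}. a * real N - real M)
        \<le> (\<Sum>x\<in>{1..M}. real (card {y \<in> {1..N}. x + y \<in> A}))"
      by (rule sum_mono)
    then show ?thesis by simp
  qed
  also have "\<dots> = (\<Sum>y\<in>{1..N}. real (card (D y)))"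
    unfolding D_def using sum_card_swap[of "{1..M}" "{1..N}" "\<lambda>x y. x + y \<in> A"]
    by (simp flip: of_nat_sum)
  also have "\<dots> - real N * real t = (\<Sum>y\<in>{1..N}. real (card (D y)) - real t)"
    by (simp add: sum_subtractf)
  \<comment> \<open>Truncation can only increase a term, and it gives the nonnegativity that
    \<open>sum_power_ge\<close> asks for.\<close>
  also have "\<dots> \<le> (\<Sum>y\<in>{1..N}. real (card (D y) - t))"
    by (intro sum_mono) linarith
  finally have avg: "real (card {1..N}) * (real M * q) \<le> (\<Sum>y\<in>{1..N}. real (card (D y) - t))"
    by simp

  have "real N * (real M * q) ^ t = real (card {1..N}) * (real M * q) ^ t"
    by simp
  also have "\<dots> \<le> (\<Sum>y\<in>{1..N}. real (card (D y) - t) ^ t)"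
    by (rule sum_power_ge[OF _ s avg]) simp
  also have "\<dots> \<le> (\<Sum>y\<in>{1..N}. real (fact t * (card (D y) choose t)))"
    by (intro sum_mono) (simp only: of_nat_power[symmetric] of_nat_le_iff diff_power_le_fact_binomial)
  also have "\<dots> = fact t * real (\<Sum>y\<in>{1..N}. card (D y) choose t)"
    by (simp add: sum_distrib_left)
  also have "(\<Sum>y\<in>{1..N}. card (D y) choose t) = (\<Sum>y\<in>{1..N}. card {B \<in> \<B>. B \<subseteq> D y})"
  proof (intro sum.cong refl)
    fix y
    have "{B \<in> \<B>. B \<subseteq> D y} = {B. B \<subseteq> D y \<and> card B = t}"
      by (auto simp: \<B>_def D_def)
    then show "(card (D y) choose t) = card {B \<in> \<B>. B \<subseteq> D y}"
      by (simp add: n_subsets D_def)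
  qed
  also have "\<dots> = (\<Sum>B\<in>\<B>. card (K B))"
    unfolding K_def by (rule sum_card_swap) (simp_all add: fin)
  finally have total: "real N * (real M * q) ^ t \<le> fact t * (\<Sum>B\<in>\<B>. real (card (K B)))"
    by simp

  have "\<exists>B\<in>\<B>. q ^ t * real N \<le> real (card (K B))"
  proof (rule ccontr)
    assume "\<not> ?thesis"
    then have small: "real (card (K B)) < q ^ t * real N" if "B \<in> \<B>" for B
      using that by force
    \<comment> \<open>The strict sum comparison below needs a member of the family; without one,
      \<open>total\<close> would bound a positive number by 0.\<close>
    have "\<B> \<noteq> {}"
    proof
      assume "\<B> = {}"
      moreover have "0 < real N * (real M * q) ^ t"
        using s MN by simp
      ultimately show False using total by simp
    qed
    then have "(\<Sum>B\<in>\<B>. real (card (K B))) < (\<Sum>B\<in>\<B>. q ^ t * real N)"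
      using small fin by (intro sum_strict_mono) auto
    then have "fact t * (\<Sum>B\<in>\<B>. real (card (K B))) < fact t * (\<Sum>B\<in>\<B>. q ^ t * real N)"
      by simp
    also have "\<dots> = real (fact t * (M choose t)) * (q ^ t * real N)"
      by (simp add: card_\<B>)
    also have "\<dots> \<le> real (M ^ t) * (q ^ t * real N)"
      using binomial_fact_pow[of M t] q
      by (intro mult_right_mono) (simp_all only: of_nat_le_iff mult.commute zero_le_mult_iff, auto)
    also have "\<dots> = real N * (real M * q) ^ t"
      by (simp add: power_mult_distrib)
    finally show False using total by simp
  qed
  then obtain B where B: "B \<in> \<B>" "q ^ t * real N \<le> real (card (K B))" ..
  have "B + K B \<subseteq> A"
    by (auto simp: K_def D_def elim!: set_plus_elim)
  with B show ?thesis
    by (intro that[of B "K B"]) (auto simp: \<B>_def K_def q_def)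
qed

text \<open>Each round splits the remaining set \<open>C\<close>. The density bounds decrease from
  round to round, so \<open>loss\<close>, stated for the last round with base lowered to
  \<open>c ^ p * \<delta>\<close>, covers all of them.\<close>

lemma dense_set_contains_iterated_sumset:
  fixes A :: "nat set" and \<delta> c :: real
  assumes A: "A \<subseteq> {1..N}" "\<delta> * real N \<le> real (card A)"
    and MN: "0 < M" "M \<le> N" and t: "0 < t"
    and c: "0 < c" "c < 1" and \<delta>: "0 < \<delta>" "\<delta> < 1"
    and loss: "real M / real N + real t / real M \<le> (c ^ p * \<delta>) ^ (t ^ (p - 1)) * (1 - c)"
    and "n \<le> p"
  shows "\<exists>B C. (\<forall>i\<in>{1..n}. B i \<subseteq> {1..N} \<and> card (B i) = t) \<and> C \<subseteq> {1..N} \<and>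
    (\<Sum>i=1..n. B i) + C \<subseteq> A \<and> (c ^ n * \<delta>) ^ (t ^ n) * real N \<le> real (card C)"
  using \<open>n \<le> p\<close>
proof (induction n)
  case 0
  show ?case
    using A by (intro exI[of _ "\<lambda>_. {}"] exI[of _ A]) simp
next
  case (Suc n)
  then obtain B C where B: "\<forall>i\<in>{1..n}. B i \<subseteq> {1..N} \<and> card (B i) = t"
    and C: "C \<subseteq> {1..N}" "(\<Sum>i=1..n. B i) + C \<subseteq> A"
      "(c ^ n * \<delta>) ^ (t ^ n) * real N \<le> real (card C)"
    by auto
  define a where "a = c ^ n * \<delta>"
  define q where "q = a ^ (t ^ n) - real M / real N - real t / real M"
  have a: "0 < a" "a \<le> 1"
    using c \<delta> by (auto simp: a_def intro!: mult_le_one power_le_one)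
  \<comment> \<open>Since \<open>t ^ n\<close> is at least 1, lowering the base from
    \<open>a\<close> to \<open>c * a\<close> frees at least the fraction \<open>1 - c\<close> of the
    density, enough for the additive loss.\<close>
  have "(c * a) ^ (t ^ n) \<le> a ^ (t ^ n) - a ^ (t ^ n) * (1 - c)"
  proof -
    have "c ^ (t ^ n) \<le> c ^ 1"
      using c t by (intro power_decreasing) (auto simp: Suc_le_eq)
    then have "c ^ (t ^ n) * a ^ (t ^ n) \<le> c * a ^ (t ^ n)"
      using a by (intro mult_right_mono) auto
    then show ?thesis
      by (simp add: power_mult_distrib algebra_simps)
  qed
  also have "\<dots> \<le> q"
  proof -
    have "(c ^ p * \<delta>) ^ (t ^ (p - 1)) \<le> a ^ (t ^ (p - 1))"
      using c \<delta> Suc.prems unfolding a_def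
      by (intro power_mono mult_right_mono power_decreasing) auto
    also have "\<dots> \<le> a ^ (t ^ n)"
      using a t Suc.prems by (intro power_decreasing power_increasing) auto
    finally have "(c ^ p * \<delta>) ^ (t ^ (p - 1)) * (1 - c) \<le> a ^ (t ^ n) * (1 - c)"
      using c by (intro mult_right_mono) auto
    with loss show ?thesis
      by (simp add: q_def)
  qed
  finally have q: "(c * a) ^ (t ^ n) \<le> q" .
  have ca: "0 < c * a" using c a by simp
  with q have "0 < q"
    by (meson less_le_trans zero_less_power)
  moreover have "a ^ (t ^ n) * real N \<le> real (card C)"
    using C(3) by (simp add: a_def)
  ultimately obtain B' C' where B': "B' \<subseteq> {1..M}" "card B' = t"
    and C': "C' \<subseteq> {1..N}" "B' + C' \<subseteq> C" "q ^ t * real N \<le> real (card C')"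
    using dense_set_contains_sumset[OF C(1), of "a ^ (t ^ n)" M t] MN unfolding q_def by auto
  have "(c ^ Suc n * \<delta>) ^ (t ^ Suc n) = ((c * a) ^ (t ^ n)) ^ t"
    by (simp add: a_def power_mult[symmetric] mult_ac)
  also have "\<dots> \<le> q ^ t"
    using q ca by (intro power_mono) auto
  finally have "(c ^ Suc n * \<delta>) ^ (t ^ Suc n) * real N \<le> q ^ t * real N"
    by (intro mult_right_mono) auto
  with C'(3) have dens: "(c ^ Suc n * \<delta>) ^ (t ^ Suc n) * real N \<le> real (card C')"
    by linarith
  have "(\<Sum>i=1..n. (B(Suc n := B')) i) = (\<Sum>i=1..n. B i)"
    by (intro sum.cong) auto
  then have "(\<Sum>i=1..Suc n. (B(Suc n := B')) i) + C' = (\<Sum>i=1..n. B i) + (B' + C')"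
    by (simp add: add.assoc)
  also have "\<dots> \<subseteq> (\<Sum>i=1..n. B i) + C"
    using C'(2) by (intro set_plus_mono2) auto
  also have "\<dots> \<subseteq> A" by (rule C(2))
  finally have sub: "(\<Sum>i=1..Suc n. (B(Suc n := B')) i) + C' \<subseteq> A" .
  have "B' \<subseteq> {1..N}"
    using B'(1) MN(2) by fastforce
  then have "\<forall>i\<in>{1..Suc n}. (B(Suc n := B')) i \<subseteq> {1..N} \<and> card ((B(Suc n := B')) i) = t"
    using B B'(2) by (auto simp: le_Suc_eq)
  with sub dens C'(1) show ?case by blast
qed

section \<open>Lower bounds for \<open>phi\<close> at fixed \<open>N\<close>\<close>

lemma le_phi:
  assumes "1 \<le> k" "\<delta> \<le> 1"
    and "\<And>A. A \<subseteq> {1..N} \<Longrightarrow> \<delta> * real N \<le> real (card A) \<Longrightarrow>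
      \<exists>B. (\<forall>i\<in>{1..k}. B i \<subseteq> {1..N} \<and> t \<le> card (B i)) \<and> (\<Sum>i=1..k. B i) \<subseteq> A"
  shows "t \<le> phi k \<delta> N"
proof -
  have "t \<le> max_min_card k N A" if A: "A \<subseteq> {1..N}" "\<delta> * real N \<le> real (card A)" for A
  proof -
    obtain B where B: "\<forall>i\<in>{1..k}. B i \<subseteq> {1..N} \<and> t \<le> card (B i)" "(\<Sum>i=1..k. B i) \<subseteq> A"
      using assms(3)[OF A] by blast
    have "t \<le> Min ((\<lambda>i. card (B i)) ` {1..k})"
      using assms(1) B(1) by (subst Min_ge_iff) auto
    also have "\<dots> \<le> max_min_card k N A"
      unfolding max_min_card_def using B
      by (intro Max_ge max_min_card_finite_nonempty[OF assms(1)]) blast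
    finally show ?thesis .
  qed
  then show ?thesis
    unfolding phi_def using phi_finite_nonempty[OF assms(2), of N]
    by (subst Min_ge_iff) auto
qed

text \<open>The set \<open>C\<close> left after \<open>p\<close> rounds becomes the last summand;
  \<open>last\<close> says that it still has \<open>t\<close> elements.\<close>

lemma le_phi_if_loss_small:
  fixes \<delta> c :: real
  assumes MN: "0 < M" "M \<le> N" and t: "0 < t"
    and c: "0 < c" "c < 1" and \<delta>: "0 < \<delta>" "\<delta> < 1"
    and loss: "real M / real N + real t / real M \<le> (c ^ p * \<delta>) ^ (t ^ (p - 1)) * (1 - c)"
    and last: "real t \<le> (c ^ p * \<delta>) ^ (t ^ p) * real N"
  shows "t \<le> phi (Suc p) \<delta> N"
proof (rule le_phi)
  fix A assume A: "A \<subseteq> {1..N}" "\<delta> * real N \<le> real (card A)"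
  obtain B C where B: "\<forall>i\<in>{1..p}. B i \<subseteq> {1..N} \<and> card (B i) = t"
    and C: "C \<subseteq> {1..N}" "(\<Sum>i=1..p. B i) + C \<subseteq> A"
      "(c ^ p * \<delta>) ^ (t ^ p) * real N \<le> real (card C)"
    using dense_set_contains_iterated_sumset[OF A MN t c \<delta> loss order_refl] by auto
  have "t \<le> card C"
    using last C(3) by simp
  then have "\<forall>i\<in>{1..Suc p}. (B(Suc p := C)) i \<subseteq> {1..N} \<and> t \<le> card ((B(Suc p := C)) i)"
    using B C(1) by (auto simp: le_Suc_eq)
  moreover have "(\<Sum>i=1..p. (B(Suc p := C)) i) = (\<Sum>i=1..p. B i)"
    by (intro sum.cong) auto
  then have "(\<Sum>i=1..Suc p. (B(Suc p := C)) i) \<subseteq> A"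
    using C(2) by simp
  ultimately show "\<exists>B. (\<forall>i\<in>{1..Suc p}. B i \<subseteq> {1..N} \<and> t \<le> card (B i)) \<and> (\<Sum>i=1..Suc p. B i) \<subseteq> A"
    by blast
qed (use \<delta> in auto)

section \<open>Choice of parameters for large \<open>N\<close>\<close>

lemma eventually_le_phi:
  fixes \<delta> r :: real and p :: nat
  assumes p: "0 < p" and \<delta>: "0 < \<delta>" "\<delta> < 1"
    and r: "0 < r" "r ^ p * ln (1 / \<delta>) < 1"
  shows "\<forall>\<^sub>F N in sequentially. nat \<lfloor>r * ln (real N) powr (1 / real p)\<rfloor> \<le> phi (Suc p) \<delta> N"
proof -
  define L where "L = ln (1 / \<delta>)"
  \<comment> \<open>This makes \<open>\<Lambda>\<close> the midpoint of \<open>L\<close> and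
    \<open>1 / r ^ p\<close>, so that \<open>\<theta> < 1\<close>, while
    \<open>c ^ p * \<delta> = exp (- \<Lambda>)\<close>.\<close>
  define \<eta> where "\<eta> = (1 / r ^ p - L) / (2 * real p)"
  define c where "c = exp (- \<eta>)"
  define \<Lambda> where "\<Lambda> = L + real p * \<eta>"
  define \<theta> where "\<theta> = r ^ p * \<Lambda>"
  have L: "0 < L" using \<delta> by (simp add: L_def)
  have "L < 1 / r ^ p"
    using r by (simp add: L_def field_simps)
  moreover have "\<Lambda> = (L + 1 / r ^ p) / 2"
    using p by (simp add: \<Lambda>_def \<eta>_def field_simps)
  ultimately have \<eta>: "0 < \<eta>" and \<Lambda>: "\<Lambda> < 1 / r ^ p"
    using p by (simp_all add: \<eta>_def)
  have \<Lambda>0: "0 < \<Lambda>" using L \<eta> p by (simp add: \<Lambda>_def add_pos_nonneg)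
  have \<theta>: "0 < \<theta>" "\<theta> < 1"
    using \<Lambda> \<Lambda>0 r by (simp_all add: \<theta>_def field_simps)
  have c: "0 < c" "c < 1" using \<eta> by (auto simp: c_def)
  have base: "(c ^ p * \<delta>) ^ m = exp (- (\<Lambda> * real m))" for m
  proof -
    have "c ^ p * \<delta> = exp (- \<Lambda>)"
      using \<delta> by (simp add: c_def \<Lambda>_def L_def exp_diff exp_add exp_minus ln_div field_simps
          flip: exp_of_nat_mult)
    then show ?thesis
      by (simp add: mult.commute flip: exp_of_nat_mult)
  qed
  define u where "u N = ln (real N) powr (1 / real p)" for N :: nat
  have ip: "0 < 1 / real p" using p by simp
  \<comment> \<open>The first condition gives \<open>t\<close> at least 4 despite the floor, the
    second yields \<open>last\<close>, and the third yields \<open>loss\<close>.\<close>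
  have "\<forall>\<^sub>F N in sequentially. 4 \<le> r * u N - 1"
    unfolding u_def using r(1) ip by real_asymp
  moreover have "\<forall>\<^sub>F N in sequentially. r * u N \<le> real N powr (1 - \<theta>)"
    unfolding u_def using r(1) ip \<theta> by real_asymp
  moreover have "\<forall>\<^sub>F N in sequentially. r * u N + 2 \<le> (1 - c) * real N powr (1/4)"
    unfolding u_def using r(1) ip c by real_asymp
  moreover have "\<forall>\<^sub>F N in sequentially. 4 \<le> N"
    by (rule eventually_ge_at_top)
  ultimately show ?thesis
  proof eventually_elim
    case (elim N)
    define t where "t = nat \<lfloor>r * u N\<rfloor>"
    \<comment> \<open>At this size \<open>M / N\<close> and \<open>t / M\<close> are at most
      \<open>2 / sqrt N\<close> and \<open>t / sqrt N\<close>.\<close>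
    define M where "M = nat \<lceil>sqrt (real N)\<rceil>"
    have t: "real t \<le> r * u N" "4 \<le> real t"
      using elim(1) by (simp_all add: t_def)
    have lnN: "0 < ln (real N)" using elim(4) by simp
    have "real t ^ p \<le> (r * u N) ^ p"
      using t by (intro power_mono) auto
    also have "\<dots> = r ^ p * ln (real N)"
      using p lnN by (simp add: u_def power_mult_distrib powr_powr flip: powr_realpow')
    finally have "\<Lambda> * real (t ^ p) \<le> \<theta> * ln (real N)"
      using \<Lambda>0 by (simp add: \<theta>_def mult_left_mono mult_ac)
    note tp = this
    \<comment> \<open>Trading one factor \<open>t\<close> for 4 shows that the density before the
      last round is at least \<open>N powr (-1/4)\<close>, well above a loss of order
      \<open>t / sqrt N\<close>.\<close>
    have tp1: "\<Lambda> * real (t ^ (p - 1)) \<le> ln (real N) / 4"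
    proof -
      have "4 * (\<Lambda> * real (t ^ (p - 1))) \<le> real t * (\<Lambda> * real (t ^ (p - 1)))"
        using t \<Lambda>0 by (intro mult_right_mono) auto
      also have "\<dots> = \<Lambda> * real (t ^ p)"
        using p by (simp add: power_eq_if)
      also have "\<dots> \<le> 1 * ln (real N)"
        using tp \<theta> lnN by (meson less_imp_le mult_right_mono order_trans)
      finally show ?thesis by simp
    qed
    have sq: "2 \<le> sqrt (real N)"
      using elim(4) by (intro real_le_rsqrt) simp
    have M: "sqrt (real N) \<le> real M" "real M \<le> 2 * sqrt (real N)"
      using sq by (simp_all add: M_def) linarith+
    have "2 * sqrt (real N) \<le> sqrt (real N) * sqrt (real N)"
      using sq by (intro mult_right_mono) auto
    then have "M \<le> N" using M(2) by simp
    have "real M / real N \<le> 2 / sqrt (real N)"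
    proof -
      have "real M / real N \<le> 2 * sqrt (real N) / (sqrt (real N) * sqrt (real N))"
        using divide_right_mono[OF M(2), of "real N"] by simp
      also have "\<dots> = 2 / sqrt (real N)"
        using sq by (simp del: real_sqrt_mult_self)
      finally show ?thesis .
    qed
    moreover have "real t / real M \<le> real t / sqrt (real N)"
      using M(1) sq by (intro divide_left_mono mult_pos_pos) linarith+
    ultimately have "real M / real N + real t / real M \<le> (real t + 2) / sqrt (real N)"
      by (simp add: add_divide_distrib)
    also have "\<dots> \<le> (1 - c) * real N powr (1/4) / sqrt (real N)"
      using elim(3) t by (intro divide_right_mono) auto
    also have "\<dots> = exp (- (ln (real N) / 4)) * (1 - c)"
    proof -
      have "real N powr (1/4) / sqrt (real N) = exp (ln (real N) / 4 - ln (real N) / 2)"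
        unfolding exp_diff using elim(4) by (simp add: powr_def powr_half_sqrt[symmetric])
      then show ?thesis
        by (simp flip: times_divide_eq_right)
    qed
    also have "\<dots> \<le> (c ^ p * \<delta>) ^ (t ^ (p - 1)) * (1 - c)"
      unfolding base using tp1 c by (intro mult_right_mono) auto
    finally have loss: "real M / real N + real t / real M
        \<le> (c ^ p * \<delta>) ^ (t ^ (p - 1)) * (1 - c)" .
    have "real t \<le> real N powr (1 - \<theta>)"
      using t elim(2) by simp
    also have "\<dots> = exp (- (\<theta> * ln (real N))) * real N"
      using elim(4) by (simp add: powr_def left_diff_distrib exp_diff exp_minus field_simps)
    also have "\<dots> \<le> (c ^ p * \<delta>) ^ (t ^ p) * real N"
      unfolding base using tp by (intro mult_right_mono) auto
    finally have "t \<le> phi (Suc p) \<delta> N"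
      using le_phi_if_loss_small[OF _ \<open>M \<le> N\<close> _ c \<delta> loss] t(2) M(1) sq by simp
    then show ?case by (simp add: t_def u_def)
  qed
qed

section \<open>Passage to the limit inferior\<close>

theorem theorem4p2:
  fixes k :: nat and \<delta> :: real
  assumes "k \<ge> 2" and "0 < \<delta>" and "\<delta> < 1"
  shows "liminf (\<lambda>N. ereal (real (phi k \<delta> N) / ln (real N) powr (1 / (real k - 1))))
           \<ge> ereal ((1 / ln (1 / \<delta>)) powr (1 / (real k - 1)))"
proof -
  define p where "p = k - 1"
  have p: "0 < p" "k = Suc p" "real k - 1 = real p"
    using assms(1) by (auto simp: p_def)
  have L: "0 < ln (1 / \<delta>)" using assms by simp
  define R where "R = (1 / ln (1 / \<delta>)) powr (1 / real p)"
  have Rp: "R ^ p = 1 / ln (1 / \<delta>)" and R0: "0 < R"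
    using L p(1) by (simp_all add: R_def powr_powr flip: powr_realpow')
  have "ereal y \<le> liminf (\<lambda>N. ereal (real (phi k \<delta> N) / ln (real N) powr (1 / real p)))"
    if "y < R" for y
  proof (rule Liminf_bounded)
    \<comment> \<open>An \<open>r\<close> strictly between leaves a gap \<open>(r - y) * u\<close>
      that tends to infinity and absorbs the floor. The maximum with 0 keeps \<open>r\<close>
      positive when \<open>y\<close> is negative.\<close>
    have "max 0 y < R" using that R0 by simp
    then obtain r where r: "max 0 y < r" "r < R"
      using dense by blast
    have "r ^ p < R ^ p" using r p by (intro power_strict_mono) auto
    then have "r ^ p * ln (1 / \<delta>) < 1"
      using L by (simp add: Rp field_simps)
    then have "\<forall>\<^sub>F N in sequentially. nat \<lfloor>r * ln (real N) powr (1 / real p)\<rfloor> \<le> phi (Suc p) \<delta> N"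
      using eventually_le_phi[OF p(1) assms(2,3), of r] r(1) by simp
    moreover have "\<forall>\<^sub>F N in sequentially. 1 \<le> (r - y) * ln (real N) powr (1 / real p)"
    proof -
      have "0 < r - y" "0 < 1 / real p" using r p by auto
      then show ?thesis by real_asymp
    qed
    \<comment> \<open>This makes the logarithm, and hence the divisor, positive.\<close>
    moreover have "\<forall>\<^sub>F N in sequentially. 2 \<le> N"
      by (rule eventually_ge_at_top)
    ultimately show "\<forall>\<^sub>F N in sequentially.
        ereal y \<le> ereal (real (phi k \<delta> N) / ln (real N) powr (1 / real p))"
    proof eventually_elim
      case (elim N)
      define u where "u = ln (real N) powr (1 / real p)"
      have "0 < u" using elim(3) by (simp add: u_def)
      have "y * u \<le> r * u - 1"
        using elim(2) by (simp add: u_def left_diff_distrib)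
      also have "\<dots> \<le> real (nat \<lfloor>r * u\<rfloor>)"
        by linarith
      also have "\<dots> \<le> real (phi k \<delta> N)"
        using elim(1) by (simp add: u_def p(2))
      finally show ?case
        using \<open>0 < u\<close> by (simp add: u_def field_simps)
    qed
  qed
  note le = this
  have "ereal R \<le> liminf (\<lambda>N. ereal (real (phi k \<delta> N) / ln (real N) powr (1 / real p)))"
  proof (rule dense_le)
    fix x assume "x < ereal R"
    then obtain y where "x < ereal y" "ereal y < ereal R"
      using ereal_dense2 by blast
    then show "x \<le> liminf (\<lambda>N. ereal (real (phi k \<delta> N) / ln (real N) powr (1 / real p)))"
      using le[of y] by simp
  qed
  then show ?thesis
    by (simp add: R_def p(3))
qed

end
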